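(* For every integer $n \geq 2$ and every non-integer real $\rho \in (0,n-1)$, the $\widetilde{\mathrm{LS}}$-rank of $P_{n,\rho} := \{x \in [0,1]^n : \sum_{i=1}^n x_i \leq n-\rho\}$ is $n$.
   Context: $[n] := \{1,\ldots,n\}$. For $P \subseteq [0,1]^n$, the integer hull is $P_I := \mathrm{conv}(P \cap \{0,1\}^n)$. For an integer $k \in [n]$ and $P \subseteq [0,1]^n$, define $$\widetilde{\mathrm{LS}}^k(P) := \bigcap_{S \subseteq [n],\, |S|=k} \mathrm{conv}\{x \in P : x_i \in \{0,1\}\ \forall i \in S\},$$ and $\widetilde{\mathrm{LS}}^0(P) := P$. The $\widetilde{\mathrm{LS}}$-rank of $P$ is the smallest integer $k \geq 0$ such that $\widetilde{\mathrm{LS}}^k(P) = P_I$. *)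

theory Defs
  imports "HOL-Analysis.Analysis"
begin

text \<open>
  The coordinates of $[0,1]^n$ are indexed by an arbitrary finite type in place of
  $\{1,\ldots,n\}$, and $n$ is its cardinality.
\<close>

definition unit_cube :: "(real ^ 'n) set" where
  "unit_cube = {x. \<forall>i. 0 \<le> x $ i \<and> x $ i \<le> 1}"

definition integer_hull :: "(real ^ 'n) set \<Rightarrow> (real ^ 'n) set" where
  "integer_hull P = convex hull (P \<inter> {x. \<forall>i. x $ i \<in> {0, 1}})"

text \<open>
  The case \<open>k = 0\<close> is separate because the general formula would give \<open>convex hull P\<close>.
  For \<open>k\<close> above the dimension, where the operator is not defined in the source, the
  intersection is empty and yields \<open>UNIV\<close>.
\<close>

definition LS_tilde :: "nat \<Rightarrow> (real ^ 'n) set \<Rightarrow> (real ^ 'n) set" where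
  "LS_tilde k P =
    (if k = 0 then P
     else \<Inter>S\<in>{S :: 'n set. card S = k}. convex hull {x \<in> P. \<forall>i\<in>S. x $ i \<in> {0, 1}})"

text \<open>
  The minimum exists and is at most the dimension, by the lemma below; so the values of
  \<open>LS_tilde k P\<close> for larger \<open>k\<close> play no role.
\<close>

definition LS_tilde_rank :: "(real ^ 'n) set \<Rightarrow> nat" where
  "LS_tilde_rank P = (LEAST k. LS_tilde k P = integer_hull P)"

lemma LS_tilde_CARD: "LS_tilde CARD('n::finite) P = integer_hull (P :: (real ^ 'n) set)"
proof -
  have "{S :: 'n set. card S = CARD('n)} = {UNIV}"
    using card_eq_UNIV_imp_eq_UNIV[OF finite] by blast
  moreover have "{x \<in> P. \<forall>i\<in>UNIV. x $ i \<in> {0, 1}} = P \<inter> {x. \<forall>i. x $ i \<in> {0, 1}}"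
    by auto
  ultimately show ?thesis
    unfolding LS_tilde_def integer_hull_def by simp
qed

definition P_poly :: "real \<Rightarrow> (real ^ 'n) set" where
  "P_poly \<rho> = {x \<in> unit_cube. (\<Sum>i\<in>UNIV. x $ i) \<le> real CARD('n) - \<rho>}"

end

theory Submission
  imports Defs
begin

text \<open>
  Write \<open>n - \<rho> = m + f\<close> with \<open>m\<close> an integer and \<open>0 < f < 1\<close>; the hypotheses on \<open>\<rho>\<close> give
  \<open>1 \<le> m \<le> n - 1\<close>. The coordinate sum of a \<open>0/1\<close> point of the polytope is an integer, so it is
  at most \<open>m\<close>, and therefore the integer hull lies in the half-space where the sum is at most
  \<open>m\<close> (\<open>sum_le_floor_on_integer_hull\<close>).

  A coordinate \<open>j\<close> that is free to be fractional gives a slack of \<open>f\<close>: with \<open>m\<close> of the other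
  coordinates equal to \<open>1\<close>, coordinate \<open>j\<close> may be \<open>f\<close>, for a sum of \<open>m + f\<close>. Averaging
  over the choice of those \<open>m\<close> coordinates produces a point with \<open>f\<close> at \<open>j\<close> and the
  constant \<open>m / (n - 1)\<close> elsewhere. This point depends on \<open>j\<close>, but mixing it,
  with positive weight, with a point of sum \<open>m\<close>, whose entry at \<open>j\<close> is \<open>0\<close> or \<open>1\<close>, equalizes all the
  coordinates (\<open>diagonal_point_in_every_hull\<close>). The resulting constant point no longer
  depends on \<open>j\<close> and still has a sum above \<open>m\<close>. If \<open>card S < n\<close>, some \<open>j\<close> is outside
  \<open>S\<close>, so the constant point survives every operator of level below \<open>n\<close>. At level \<open>n\<close>
  the operator is the integer hull.
\<close>

text \<open>
  The point is the average of the given ones over all the \<open>r\<close>-subsets of \<open>- {j}\<close>. The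
  coordinate \<open>i \<noteq> j\<close> of the average is the fraction of \<open>r\<close>-subsets that contain \<open>i\<close>. The
  \<open>r\<close>-subsets that avoid \<open>i\<close> are those of a set with one element less, and they make up
  \<open>1 - r / (n - 1)\<close> of the total.
\<close>

lemma averaged_indicator_mem_convex:
  fixes X :: "(real ^ 'n::finite) set" and j :: 'n
  assumes "convex X" and card2: "CARD('n) \<ge> 2" and r: "r \<le> CARD('n) - 1"
    and mem: "\<And>T. T \<subseteq> - {j} \<Longrightarrow> card T = r \<Longrightarrow> (\<chi> i. if i = j then a else of_bool (i \<in> T)) \<in> X"
  shows "(\<chi> i. if i = j then a else real r / (real CARD('n) - 1)) \<in> X"
proof -
  define N where "N = CARD('n) - 1"
  define F where "F = {T. T \<subseteq> - {j} \<and> card T = r}"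
  define C where "C = real (card F)"
  have N: "card (- {j}) = N" "real CARD('n) - 1 = real N" "N > 0" "r \<le> N"
    using card2 r by (auto simp: N_def Compl_eq_Diff_UNIV card_Diff_singleton)
  have C_eq: "C = real (N choose r)"
    unfolding C_def F_def by (simp only: n_subsets[OF finite] N)
  then have C0: "C > 0"
    using N by simp
  have weights: "(\<Sum>T\<in>F. 1 / C) = 1"
    using C0 by (simp only: sum_constant C_def[symmetric]) simp
  have "(\<Sum>T\<in>F. (1 / C) *\<^sub>R (\<chi> i. if i = j then a else of_bool (i \<in> T))) \<in> X"
    using C0 by (intro convex_sum[OF finite \<open>convex X\<close> weights] mem) (auto simp: F_def)
  also have "(\<Sum>T\<in>F. (1 / C) *\<^sub>R (\<chi> i. if i = j then a else of_bool (i \<in> T)))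
      = (\<chi> i. if i = j then a else real r / real N)"
  proof (intro iffD2[OF vec_eq_iff] allI)
    fix i
    have "(\<Sum>T\<in>F. of_bool (i \<in> T)) = real r / real N * C" if "i \<noteq> j"
    proof -
      have "{T \<in> F. i \<notin> T} = {T. T \<subseteq> - {j} - {i} \<and> card T = r}"
        by (auto simp: F_def)
      then have "card {T \<in> F. i \<notin> T} = (N - 1) choose r"
        using that N by (simp add: n_subsets card_Diff_singleton)
      moreover have "(N - r) * (N choose r) = N * ((N - 1) choose r)"
        by (rule binomial_absorb_comp)
      then have "(real N - real r) * C = real N * real ((N - 1) choose r)"
        using N by (metis C_eq of_nat_diff of_nat_mult)
      ultimately have "real N * (C - real (card {T \<in> F. i \<notin> T})) = real r * C"
        by (simp add: algebra_simps)
      moreover have "(\<Sum>T\<in>F. of_bool (i \<in> T)) = C - real (card {T \<in> F. i \<notin> T})"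
      proof -
        have "(\<Sum>T\<in>F. of_bool (i \<in> T)) = (\<Sum>T\<in>F. 1 - of_bool (i \<notin> T) :: real)"
          by (intro sum.cong) auto
        also have "\<dots> = C - real (card {T \<in> F. i \<notin> T})"
          by (simp add: sum_subtractf C_def Int_def)
        finally show ?thesis .
      qed
      ultimately have "real N * (\<Sum>T\<in>F. of_bool (i \<in> T)) = real r * C"
        by simp
      then show ?thesis
        using N(3) by (simp add: field_simps del: sum_of_bool_eq)
    qed
    then show "(\<Sum>T\<in>F. (1 / C) *\<^sub>R (\<chi> i. if i = j then a else of_bool (i \<in> T))) $ i
        = (\<chi> i. if i = j then a else real r / real N) $ i"
      using C0 by (auto simp: C_def[symmetric] sum_divide_distrib[symmetric])
  qed
  finally show ?thesis
    by (simp only: N(2))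
qed

lemma averaged_point_in_hull:
  fixes j :: "'n::finite"
  assumes "CARD('n) \<ge> 2" and "r \<le> CARD('n) - 1" and a: "0 \<le> a" "a \<le> 1"
    and sum: "a + real r \<le> real CARD('n) - \<rho>"
  shows "(\<chi> i. if i = j then a else real r / (real CARD('n) - 1))
    \<in> convex hull {x \<in> P_poly \<rho> :: (real ^ 'n) set. \<forall>i\<in>- {j}. x $ i \<in> {0, 1}}"
proof (rule averaged_indicator_mem_convex[OF convex_convex_hull assms(1,2)])
  fix T :: "'n set"
  assume T: "T \<subseteq> - {j}" "card T = r"
  have "(\<Sum>i\<in>UNIV. if i = j then a else of_bool (i \<in> T)) = a + (\<Sum>i\<in>- {j}. of_bool (i \<in> T))"
    by (subst sum.remove[of _ j]) (auto simp: Compl_eq_Diff_UNIV intro!: sum.cong)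
  also have "(\<Sum>i\<in>- {j}. of_bool (i \<in> T)) = real r"
    using T by (simp add: Int_absorb1)
  finally show "(\<chi> i. if i = j then a else of_bool (i \<in> T))
      \<in> convex hull {x \<in> P_poly \<rho>. \<forall>i\<in>- {j}. x $ i \<in> {0, 1}}"
    using a sum by (intro hull_inc) (auto simp: P_poly_def unit_cube_def)
qed

text \<open>
  With \<open>N = n - 1\<close>, the averaged point of sum \<open>m + f\<close> has the entry \<open>f\<close> at \<open>j\<close> and
  \<open>m / N\<close> elsewhere. If \<open>f \<le> m / N\<close>, the entry at \<open>j\<close> has to be raised, so the second
  point has \<open>1\<close> at \<open>j\<close> and \<open>(m - 1) / N\<close> elsewhere; otherwise it has to be lowered, and
  the second point has \<open>0\<close> at \<open>j\<close> and \<open>m / N\<close> elsewhere. In both cases the second point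
  has sum \<open>m\<close> and the first one has positive weight. For \<open>m = 0\<close> the weight in the second
  case would vanish.
\<close>

lemma diagonal_point_in_every_hull:
  assumes card2: "CARD('n::finite) \<ge> 2" and m: "1 \<le> m" "m \<le> CARD('n) - 1"
    and f: "0 < f" "f < 1" and \<rho>: "real CARD('n) - \<rho> = real m + f"
  obtains t where "real m < real CARD('n) * t"
    and "\<And>j. (\<chi> i. t) \<in> convex hull {x \<in> P_poly \<rho> :: (real ^ 'n) set. \<forall>i\<in>- {j}. x $ i \<in> {0, 1}}"
proof -
  let ?H = "\<lambda>j. convex hull {x \<in> P_poly \<rho> :: (real ^ 'n) set. \<forall>i\<in>- {j}. x $ i \<in> {0, 1}}"
  define N where "N = real CARD('n) - 1"
  have N: "1 \<le> N" "real m \<le> N" "real CARD('n) = N + 1"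
    using card2 m by (auto simp: N_def)
  have u: "(\<chi> i. if i = j then f else real m / N) \<in> ?H j" for j
    unfolding N_def using assms by (intro averaged_point_in_hull) auto
  have combine: "(\<chi> i. t) \<in> ?H j"
    if v: "(\<chi> i. if i = j then b else c) \<in> ?H j" and l: "0 \<le> l" "l \<le> 1"
      and t: "t = l * f + (1 - l) * b" "t = l * (real m / N) + (1 - l) * c" for t j b c l
  proof -
    have "l *\<^sub>R (\<chi> i. if i = j then f else real m / N) + (1 - l) *\<^sub>R (\<chi> i. if i = j then b else c) \<in> ?H j"
      using l by (intro convexD[OF convex_convex_hull u v]) auto
    also have "l *\<^sub>R (\<chi> i. if i = j then f else real m / N) + (1 - l) *\<^sub>R (\<chi> i. if i = j then b else c)
        = (\<chi> i. t)"
      using t by (auto simp: vec_eq_iff)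
    finally show ?thesis .
  qed
  show thesis
  proof (cases "f \<le> real m / N")
    case True
    define D where "D = N * (1 - f) + 1"
    \<comment> \<open>The weight \<open>l\<close> solves \<open>l * f + (1 - l) * 1 = l * (m / N) + (1 - l) * ((m - 1) / N)\<close>.\<close>
    define l where "l = (N - real m + 1) / D"
    define t where "t = l * f + (1 - l) * 1"
    have "0 \<le> N * (1 - f)"
      using N f by simp
    then have D: "0 < D"
      by (simp add: D_def)
    then have l: "0 < l" "l \<le> 1" "l * D = N - real m + 1"
      using True N by (auto simp: l_def D_def field_simps)
    have t: "t = l * (real m / N) + (1 - l) * (real (m - 1) / N)"
      using l(3) N m by (simp add: t_def D_def field_simps of_nat_diff)
    have v: "(\<chi> i. if i = j then 1 else real (m - 1) / N) \<in> ?H j" for j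
      unfolding N_def using assms by (intro averaged_point_in_hull) (auto simp: of_nat_diff)
    \<comment> \<open>The coordinate sum is the average of \<open>m + f\<close> and \<open>m\<close> with weights \<open>l\<close> and \<open>1 - l\<close>.\<close>
    have "N * t = real m - 1 + l"
      using N m by (simp add: t field_simps of_nat_diff)
    moreover have "(N + 1) * t = N * t + t"
      by (simp add: distrib_right)
    ultimately have "(N + 1) * t = real m + l * f"
      using t_def by simp
    then have "real m < real CARD('n) * t"
      using l f N by simp
    then show thesis
      using that combine[OF v] l t_def t by simp
  next
    case False
    \<comment> \<open>The weight \<open>l\<close> solves \<open>l * f + (1 - l) * 0 = m / N\<close>, the second point being \<open>0\<close> at \<open>j\<close>.\<close>
    define t where "t = real m / N"
    define l where "l = t / f"
    have "0 \<le> t" "t \<le> f"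
      using False N by (auto simp: t_def)
    then have l: "0 \<le> l" "l \<le> 1" "l * f = t"
      using f by (auto simp: l_def)
    have v: "(\<chi> i. if i = j then 0 else real m / N) \<in> ?H j" for j
      unfolding N_def using assms by (intro averaged_point_in_hull) auto
    have "real m < (N + 1) * t"
      using N m by (simp add: t_def field_simps)
    then have "real m < real CARD('n) * t"
      using N by simp
    moreover have "t = l * f + (1 - l) * 0" "t = l * (real m / N) + (1 - l) * (real m / N)"
      using l(3) by (simp_all add: left_diff_distrib flip: t_def)
    ultimately show thesis
      using that combine[OF v l(1,2)] by blast
  qed
qed

lemma sum_le_floor_on_integer_hull:
  assumes "x \<in> integer_hull (P_poly \<rho> :: (real ^ 'n::finite) set)"
  shows "(\<Sum>i\<in>UNIV. x $ i) \<le> of_int \<lfloor>real CARD('n) - \<rho>\<rfloor>"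
proof -
  let ?h = "{x :: real ^ 'n. (\<Sum>i\<in>UNIV. x $ i) \<le> of_int \<lfloor>real CARD('n) - \<rho>\<rfloor>}"
  have "?h = {x. (\<chi> i. 1) \<bullet> x \<le> of_int \<lfloor>real CARD('n) - \<rho>\<rfloor>}"
    by (simp add: inner_vec_def)
  then have "convex ?h"
    by (simp only: convex_halfspace_le)
  moreover have "y \<in> ?h" if y: "y \<in> P_poly \<rho>" "\<forall>i. y $ i \<in> {0, 1}" for y
  proof -
    have "(\<Sum>i\<in>UNIV. y $ i) \<in> \<int>"
      using y(2) by (intro Ints_sum) (metis Ints_0 Ints_1 insertE singletonD)
    then obtain z where z: "(\<Sum>i\<in>UNIV. y $ i) = of_int z"
      by (auto elim: Ints_cases)
    then show ?thesis
      using y(1) by (simp add: P_poly_def le_floor_iff)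
  qed
  ultimately have "integer_hull (P_poly \<rho>) \<subseteq> ?h"
    unfolding integer_hull_def by (intro hull_minimal) auto
  then show ?thesis
    using assms by auto
qed

text \<open>
  Leaving only one coordinate free is the strongest condition among the levels below the
  dimension, since every proper subset \<open>S\<close> lies in some \<open>- {j}\<close>. Convexity of \<open>P\<close> is for
  \<open>k = 0\<close>, where the operator takes no hull.
\<close>

lemma mem_LS_tilde_if_mem_one_free_hulls:
  fixes P :: "(real ^ 'n::finite) set"
  assumes "convex P" and "k < CARD('n)"
    and x: "\<And>j. x \<in> convex hull {x \<in> P. \<forall>i\<in>- {j}. x $ i \<in> {0, 1}}"
  shows "x \<in> LS_tilde k P"
proof (cases "k = 0")
  case True
  have "convex hull {x \<in> P. \<forall>i\<in>- {j}. x $ i \<in> {0, 1}} \<subseteq> P" for j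
    using \<open>convex P\<close> by (intro hull_minimal) auto
  then show ?thesis
    using x True by (auto simp: LS_tilde_def)
next
  case False
  have "x \<in> convex hull {x \<in> P. \<forall>i\<in>S. x $ i \<in> {0, 1}}" if S: "card S = k" for S :: "'n set"
  proof -
    obtain j where "j \<notin> S"
      using S assms(2) by (metis UNIV_eq_I less_irrefl)
    then have "convex hull {x \<in> P. \<forall>i\<in>- {j}. x $ i \<in> {0, 1}}
        \<subseteq> convex hull {x \<in> P. \<forall>i\<in>S. x $ i \<in> {0, 1}}"
      by (intro hull_mono) auto
    then show ?thesis
      using x by blast
  qed
  then show ?thesis
    using False by (auto simp: LS_tilde_def)
qed

lemma convex_P_poly: "convex (P_poly \<rho> :: (real ^ 'n::finite) set)"
proof -
  have "P_poly \<rho> = cbox 0 1 \<inter> {x :: real ^ 'n. (\<chi> i. 1) \<bullet> x \<le> real CARD('n) - \<rho>}"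
    by (auto simp: P_poly_def unit_cube_def mem_box_cart inner_vec_def)
  then show ?thesis
    by (simp only: convex_Int convex_box convex_halfspace_le)
qed

theorem proposition5:
  fixes \<rho> :: real
  assumes "CARD('n::finite) \<ge> 2"
    and "0 < \<rho>" and "\<rho> < real CARD('n) - 1"
    and "\<rho> \<notin> \<int>"
  shows "LS_tilde_rank (P_poly \<rho> :: (real ^ 'n) set) = CARD('n)"
proof -
  define m where "m = nat \<lfloor>real CARD('n) - \<rho>\<rfloor>"
  define f where "f = real CARD('n) - \<rho> - real m"
  have m_floor: "real m = of_int \<lfloor>real CARD('n) - \<rho>\<rfloor>"
    using assms(3) by (simp add: m_def)
  have "f \<noteq> 0"
  proof
    assume "f = 0"
    then have "\<rho> = real CARD('n) - real m"
      by (simp add: f_def)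
    then show False
      using assms(4) by simp
  qed
  moreover have "0 \<le> f" "f < 1"
    unfolding f_def m_floor by linarith+
  ultimately have f: "0 < f" "f < 1"
    by auto
  have "real m < real CARD('n)" "1 < real m + f"
    using f assms(2,3) by (auto simp: f_def)
  then have m: "1 \<le> m" "m \<le> CARD('n) - 1"
    using f by (cases m; simp)+
  have \<rho>: "real CARD('n) - \<rho> = real m + f"
    by (simp add: f_def)
  obtain t where t: "real m < real CARD('n) * t"
      "\<And>j. (\<chi> i. t) \<in> convex hull {x \<in> P_poly \<rho> :: (real ^ 'n) set. \<forall>i\<in>- {j}. x $ i \<in> {0, 1}}"
    using diagonal_point_in_every_hull[OF assms(1) m f \<rho>] by blast
  have "(\<chi> i. t) \<notin> integer_hull (P_poly \<rho> :: (real ^ 'n) set)"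
    using sum_le_floor_on_integer_hull[of "(\<chi> i. t) :: real ^ 'n" \<rho>] t(1) m_floor by auto
  moreover have "(\<chi> i. t) \<in> LS_tilde k (P_poly \<rho> :: (real ^ 'n) set)" if "k < CARD('n)" for k
    by (rule mem_LS_tilde_if_mem_one_free_hulls[OF convex_P_poly that t(2)])
  ultimately have "CARD('n) \<le> k"
    if "LS_tilde k (P_poly \<rho> :: (real ^ 'n) set) = integer_hull (P_poly \<rho>)" for k
    using that by (metis not_less)
  then show ?thesis
    unfolding LS_tilde_rank_def by (intro Least_equality LS_tilde_CARD)
qed

end
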